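(* Let $k,d\in\mathbb{N}$ and $m^{(d)}=(m_1,\ldots,m_d)\in\mathbb{N}^d$. Let $a_d=\sum_{w\in T(m^{(d)},k)}\mathrm{des}(w)$ be the total number of descents of all $m^{(d)}$-tensor words over $[k]$. Then $$a_d=\frac{1}{2}\left(d\prod_{\ell\in[d]}m_{\ell}-\sum_{i\in[d]}\prod_{\ell\in[d],\,\ell\neq i}m_{\ell}\right)(k-1)k^{\prod_{\ell\in[d]}m_{\ell}-1}.$$ Moreover, with $m_1,\ldots,m_d$ fixed, let $a_{d+1}=a_{d+1}(m_1,\dots,m_d,m_{d+1})$ be the analogous total for $m^{(d+1)}=(m_1,\ldots,m_d,m_{d+1})$, and let $A_{d+1}(x)=\sum_{m_{d+1}\geq 1}a_{d+1}(m_1,\ldots,m_d,m_{d+1})\,x^{m_{d+1}}$ be the corresponding generating function (a formal power series in $x$). Then $$A_{d+1}(x)=\frac{a_{d}x+\frac{1}{2}(k-1)k^{2\prod_{\ell\in[d]}m_{\ell}-1}\left(\prod_{\ell\in[d]}m_{\ell}\right)x^{2}}{\left(1-k^{\prod_{\ell\in[d]}m_{\ell}}x\right)^{2}}.$$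
   Context: $\mathbb{N}=\{1,2,\ldots\}$ and $[n]=\{1,\ldots,n\}$. An empty product equals $1$. For $m^{(d)}=(m_1,\ldots,m_d)\in\mathbb{N}^d$, an $m^{(d)}$-tensor word over $[k]$ is a function $w\colon[m_1]\times\cdots\times[m_d]\to[k]$; $T(m^{(d)},k)$ denotes the set of all of them. With $e_\ell$ the $\ell$th standard basis vector of $\mathbb{R}^d$, a descent of $w$ is a pair $(i,j)\in([m_1]\times\cdots\times[m_d])^2$ such that $w(i)>w(j)$ and $j=i+e_\ell$ for some $\ell\in[d]$. $\mathrm{des}(w)$ denotes the number of descents of $w$. *)

theory Defs
  imports
    Complex_Main
    "HOL-Library.FuncSet"
    "HOL-Computational_Algebra.Formal_Power_Series"
begin

text \<open>
  A size vector \<open>(m\<^sub>1, \<dots>, m\<^sub>d)\<close> is a function \<open>m :: nat \<Rightarrow> nat\<close> of which only the values on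
  \<open>{1..d}\<close> matter. Positions and words are extensional functions, i.e. they are \<open>undefined\<close>
  outside their domain, so that distinct elements of the sets below are distinct as
  mathematical objects and the sums and cardinalities below count each of them once.
\<close>

definition grid :: "nat \<Rightarrow> (nat \<Rightarrow> nat) \<Rightarrow> (nat \<Rightarrow> nat) set" where
  "grid d m = (\<Pi>\<^sub>E l\<in>{1..d}. {1..m l})"

definition tensor_words :: "nat \<Rightarrow> (nat \<Rightarrow> nat) \<Rightarrow> nat \<Rightarrow> ((nat \<Rightarrow> nat) \<Rightarrow> nat) set" where
  "tensor_words d m k = grid d m \<rightarrow>\<^sub>E {1..k}"

definition unit_vec :: "nat \<Rightarrow> nat \<Rightarrow> nat" where
  "unit_vec l t = (if t = l then 1 else 0)"

definition descents ::
    "nat \<Rightarrow> (nat \<Rightarrow> nat) \<Rightarrow> ((nat \<Rightarrow> nat) \<Rightarrow> nat) \<Rightarrow> ((nat \<Rightarrow> nat) \<times> (nat \<Rightarrow> nat)) set" where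
  "descents d m w =
     {(i, j). i \<in> grid d m \<and> j \<in> grid d m \<and> w i > w j \<and>
        (\<exists>l\<in>{1..d}. \<forall>t\<in>{1..d}. j t = i t + unit_vec l t)}"

definition des :: "nat \<Rightarrow> (nat \<Rightarrow> nat) \<Rightarrow> ((nat \<Rightarrow> nat) \<Rightarrow> nat) \<Rightarrow> nat" where
  "des d m w = card (descents d m w)"

definition total_des :: "nat \<Rightarrow> (nat \<Rightarrow> nat) \<Rightarrow> nat \<Rightarrow> nat" where
  "total_des d m k = (\<Sum>w\<in>tensor_words d m k. des d m w)"

text \<open>
  Generating function in the last side length \<open>n = m\<^sub>d\<^sub>+\<^sub>1\<close>, with \<open>m\<^sub>1, \<dots>, m\<^sub>d\<close> fixed. The
  summation starts at \<open>n = 1\<close>.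
\<close>

definition total_des_gf :: "nat \<Rightarrow> (nat \<Rightarrow> nat) \<Rightarrow> nat \<Rightarrow> real fps" where
  "total_des_gf d m k =
     Abs_fps (\<lambda>n. if n \<ge> 1 then real (total_des (d + 1) (m(d + 1 := n)) k) else 0)"

end

theory Submission
  imports Defs
begin

text \<open>
  Call a pair \<open>(i, j)\<close> of cells with \<open>j = i + e\<^sub>l\<close> for some \<open>l\<close> a step of the grid. Exchanging
  the number of words and the number of steps (double counting) turns the total number of
  descents into a sum, over all steps, of the number of words that decrease along that step. The
  two cells of a step are distinct, so exchanging the letters at these cells shows that as many
  words decrease as increase along it, while \<open>k ^ (M - 1)\<close> of the \<open>k ^ M\<close> words are constant
  along it, where \<open>M\<close> is the number of cells. Hence every step contributes
  \<open>(k - 1) * k ^ (M - 1) / 2\<close>, whichever step it is (\<open>card_decreasing_at\<close>). The steps in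
  direction \<open>l\<close> correspond to their starting cells, which fill a grid that is shorter by one in
  direction \<open>l\<close>; summing over \<open>l\<close> gives the bracket of the closed formula (\<open>card_steps\<close>).

  For the generating function, put \<open>q = k ^ M\<close>. Adding a dimension of length \<open>n\<close> to the closed
  formula gives \<open>n * a * q ^ (n - 1) + (n - 1) * b * q ^ (n - 2)\<close>: the first summand, with \<open>a\<close>
  the total for one layer, comes from the descents inside one of the \<open>n\<close> layers, the second one
  from the \<open>(n - 1) * M\<close> steps between consecutive layers. Both are coefficients of multiples of
  the power series \<open>X / (1 - q X)\<^sup>2\<close>, whose \<open>n\<close>-th coefficient is \<open>n * q ^ (n - 1)\<close>.
\<close>

section \<open>Words that decrease between two given cells\<close>

text \<open>
  A function that agrees at \<open>i\<close> and \<open>j\<close> is determined by its restriction to the complement of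
  \<open>i\<close>, and that restriction is arbitrary.
\<close>

lemma card_equal_at:
  assumes "finite A" "i \<in> A" "j \<in> A" "i \<noteq> j"
  shows "card {w \<in> A \<rightarrow>\<^sub>E B. w i = w j} = card B ^ (card A - 1)"
proof -
  have "bij_betw (\<lambda>w. restrict w (A - {i})) {w \<in> A \<rightarrow>\<^sub>E B. w i = w j} ((A - {i}) \<rightarrow>\<^sub>E B)"
  proof (rule bij_betw_byWitness[where f' = "\<lambda>v. v(i := v j)"])
    show "\<forall>w\<in>{w \<in> A \<rightarrow>\<^sub>E B. w i = w j}.
        (restrict w (A - {i}))(i := restrict w (A - {i}) j) = w"
      using assms by (auto simp: fun_eq_iff PiE_def extensional_def)
    show "\<forall>v\<in>(A - {i}) \<rightarrow>\<^sub>E B. restrict (v(i := v j)) (A - {i}) = v"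
      using assms by (auto simp: fun_eq_iff PiE_def extensional_def)
    show "(\<lambda>w. restrict w (A - {i})) ` {w \<in> A \<rightarrow>\<^sub>E B. w i = w j} \<subseteq> (A - {i}) \<rightarrow>\<^sub>E B"
      by (auto simp: PiE_def Pi_def)
    show "(\<lambda>v. v(i := v j)) ` ((A - {i}) \<rightarrow>\<^sub>E B) \<subseteq> {w \<in> A \<rightarrow>\<^sub>E B. w i = w j}"
      using assms by (auto simp: PiE_def extensional_def Pi_def)
  qed
  then have "card {w \<in> A \<rightarrow>\<^sub>E B. w i = w j} = card ((A - {i}) \<rightarrow>\<^sub>E B)"
    by (rule bij_betw_same_card)
  also have "\<dots> = card B ^ (card A - 1)"
    using assms by (simp add: card_funcsetE)
  finally show ?thesis .
qed

text \<open>Exchanging the values at \<open>i\<close> and \<open>j\<close> is an involution that reverses the inequality.\<close>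

lemma card_less_at_commute:
  fixes B :: "'b::order set"
  assumes "i \<in> A" "j \<in> A"
  shows "card {w \<in> A \<rightarrow>\<^sub>E B. w i < w j} = card {w \<in> A \<rightarrow>\<^sub>E B. w j < w i}"
proof (rule bij_betw_same_card)
  show "bij_betw (\<lambda>w. w(i := w j, j := w i)) {w \<in> A \<rightarrow>\<^sub>E B. w i < w j} {w \<in> A \<rightarrow>\<^sub>E B. w j < w i}"
    by (rule bij_betw_byWitness[where f' = "\<lambda>w. w(i := w j, j := w i)"])
      (use assms in \<open>auto simp: fun_eq_iff PiE_def extensional_def Pi_def\<close>)
qed

lemma card_decreasing_at:
  fixes B :: "'b::linorder set"
  assumes "finite A" "finite B" "i \<in> A" "j \<in> A" "i \<noteq> j"
  shows "2 * real (card {w \<in> A \<rightarrow>\<^sub>E B. w j < w i}) = (real (card B) - 1) * real (card B) ^ (card A - 1)"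
proof -
  let ?L = "{w \<in> A \<rightarrow>\<^sub>E B. w i < w j}" and ?G = "{w \<in> A \<rightarrow>\<^sub>E B. w j < w i}"
    and ?E = "{w \<in> A \<rightarrow>\<^sub>E B. w i = w j}"
  have fin: "finite (A \<rightarrow>\<^sub>E B)"
    using assms by (intro finite_PiE) auto
  have "A \<rightarrow>\<^sub>E B = (?L \<union> ?G) \<union> ?E"
    using linorder_less_linear by blast
  then have "card (A \<rightarrow>\<^sub>E B) = card ((?L \<union> ?G) \<union> ?E)"
    by simp
  also have "\<dots> = card (?L \<union> ?G) + card ?E"
    using fin by (intro card_Un_disjoint) auto
  also have "card (?L \<union> ?G) = card ?L + card ?G"
    using fin by (intro card_Un_disjoint) auto
  finally have "card B ^ card A = 2 * card ?G + card B ^ (card A - 1)"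
    using assms card_less_at_commute[of i A j B] card_equal_at[of A i j B]
    by (simp add: card_funcsetE)
  moreover have "card B ^ card A = card B * card B ^ (card A - 1)"
  proof -
    have "card A \<noteq> 0"
      using assms by auto
    then show ?thesis
      by (cases "card A") auto
  qed
  ultimately have "card B * card B ^ (card A - 1) = 2 * card ?G + card B ^ (card A - 1)"
    by simp
  then have "real (card B * card B ^ (card A - 1)) = real (2 * card ?G + card B ^ (card A - 1))"
    by (rule arg_cong)
  then show ?thesis
    by (simp add: algebra_simps)
qed

section \<open>Steps of the grid\<close>

definition steps :: "nat \<Rightarrow> (nat \<Rightarrow> nat) \<Rightarrow> ((nat \<Rightarrow> nat) \<times> (nat \<Rightarrow> nat)) set" where
  "steps d m = {(i, j). i \<in> grid d m \<and> j \<in> grid d m \<and>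
     (\<exists>l\<in>{1..d}. \<forall>t\<in>{1..d}. j t = i t + unit_vec l t)}"

lemma finite_grid: "finite (grid d m)"
  unfolding grid_def by (intro finite_PiE) auto

lemma card_grid: "card (grid d m) = (\<Prod>l\<in>{1..d}. m l)"
  unfolding grid_def by (simp add: card_PiE)

lemma finite_steps: "finite (steps d m)"
  by (rule finite_subset[of _ "grid d m \<times> grid d m"]) (auto simp: steps_def finite_grid)

lemma steps_distinct: "(i, j) \<in> steps d m \<Longrightarrow> i \<noteq> j"
  by (auto simp: steps_def unit_vec_def)

text \<open>
  The direction \<open>l\<close> of a step is the only coordinate in which its two cells differ, and the
  starting cells of the steps in direction \<open>l\<close> are those whose \<open>l\<close>-th coordinate is not maximal.
\<close>

lemma bij_betw_steps:
  assumes "\<And>l. l \<in> {1..d} \<Longrightarrow> m l \<ge> 1"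
  shows "bij_betw (\<lambda>(l, i). (i, i(l := i l + 1)))
     (SIGMA l:{1..d}. grid d (m(l := m l - 1))) (steps d m)"
  unfolding bij_betw_def
proof
  show "inj_on (\<lambda>(l, i). (i, i(l := i l + 1))) (SIGMA l:{1..d}. grid d (m(l := m l - 1)))"
    by (auto simp: inj_on_def fun_eq_iff split: if_splits)
  show "(\<lambda>(l, i). (i, i(l := i l + 1))) ` (SIGMA l:{1..d}. grid d (m(l := m l - 1))) = steps d m"
    (is "?f ` ?S = _")
  proof
    show "?f ` ?S \<subseteq> steps d m"
    proof
      fix p assume "p \<in> ?f ` ?S"
      then obtain l i where l: "l \<in> {1..d}" and i: "i \<in> grid d (m(l := m l - 1))"
        and p: "p = (i, i(l := i l + 1))"
        by auto
      have il: "i l \<in> {1..m l - 1}"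
        using i l unfolding grid_def by (auto dest!: PiE_mem[where x = l])
      have it: "i t \<in> {1..m t}" if "t \<in> {1..d}" for t
        using PiE_mem[OF i[unfolded grid_def] that] by (auto split: if_splits)
      have ext: "i t = undefined" if "t \<notin> {1..d}" for t
        using PiE_arb[OF i[unfolded grid_def] that] .
      have "i \<in> grid d m"
        unfolding grid_def by (rule PiE_I) (use it ext in auto)
      moreover have "i l + 1 \<le> m l"
        using il by auto
      then have "i(l := i l + 1) \<in> grid d m"
        unfolding grid_def by (intro PiE_I) (use it ext l in \<open>auto split: if_splits\<close>)
      ultimately show "p \<in> steps d m"
        unfolding p steps_def using l by (auto simp: unit_vec_def intro!: bexI[of _ l])
    qed
    show "steps d m \<subseteq> ?f ` ?S"
    proof
      fix p assume "p \<in> steps d m"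
      then obtain i j l where p: "p = (i, j)" and i: "i \<in> grid d m" and j: "j \<in> grid d m"
        and l: "l \<in> {1..d}" and eq: "\<And>t. t \<in> {1..d} \<Longrightarrow> j t = i t + unit_vec l t"
        by (auto simp: steps_def)
      have ext: "i t = undefined" "j t = undefined" if "t \<notin> {1..d}" for t
        using PiE_arb[OF i[unfolded grid_def] that] PiE_arb[OF j[unfolded grid_def] that] .
      have it: "i t \<in> {1..m t}" if "t \<in> {1..d}" for t
        using PiE_mem[OF i[unfolded grid_def] that] .
      have "j l \<le> m l"
        using PiE_mem[OF j[unfolded grid_def] l] by simp
      then have il: "i l \<le> m l - 1"
        using eq[OF l] by (simp add: unit_vec_def)
      have "i \<in> grid d (m(l := m l - 1))"
        unfolding grid_def by (rule PiE_I) (use it il ext in auto)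
      moreover have "j = i(l := i l + 1)"
      proof
        show "j t = (i(l := i l + 1)) t" for t
          using eq[of t] ext[of t] l by (cases "t \<in> {1..d}") (auto simp: unit_vec_def)
      qed
      ultimately show "p \<in> ?f ` ?S"
        unfolding p using l by force
    qed
  qed
qed

lemma card_steps:
  assumes "\<And>l. l \<in> {1..d} \<Longrightarrow> m l \<ge> 1"
  shows "real (card (steps d m)) =
     real d * (\<Prod>l\<in>{1..d}. real (m l)) - (\<Sum>i\<in>{1..d}. \<Prod>l\<in>{1..d} - {i}. real (m l))"
proof -
  have term_eq: "real (card (grid d (m(i := m i - 1))))
      = (\<Prod>l\<in>{1..d}. real (m l)) - (\<Prod>l\<in>{1..d} - {i}. real (m l))" if i: "i \<in> {1..d}" for i
  proof -
    have "real (card (grid d (m(i := m i - 1))))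
        = (\<Prod>l\<in>{1..d}. real ((m(i := m i - 1)) l))"
      by (simp add: card_grid)
    also have "\<dots> = real (m i - 1) * (\<Prod>l\<in>{1..d} - {i}. real ((m(i := m i - 1)) l))"
      using i by (subst prod.remove[of _ i]) auto
    also have "(\<Prod>l\<in>{1..d} - {i}. real ((m(i := m i - 1)) l)) = (\<Prod>l\<in>{1..d} - {i}. real (m l))"
      by (intro prod.cong) auto
    also have "real (m i - 1) = real (m i) - 1"
      using assms[OF i] by (simp add: of_nat_diff)
    also have "(real (m i) - 1) * (\<Prod>l\<in>{1..d} - {i}. real (m l))
        = (\<Prod>l\<in>{1..d}. real (m l)) - (\<Prod>l\<in>{1..d} - {i}. real (m l))"
      using prod.remove[of "{1..d}" i "\<lambda>l. real (m l)"] i by (simp add: algebra_simps)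
    finally show ?thesis .
  qed
  have "card (steps d m) = (\<Sum>i\<in>{1..d}. card (grid d (m(i := m i - 1))))"
    using bij_betw_same_card[OF bij_betw_steps[of d m, OF assms]] by (simp add: finite_grid)
  then have "real (card (steps d m)) = (\<Sum>i\<in>{1..d}. real (card (grid d (m(i := m i - 1)))))"
    by simp
  also have "\<dots> = (\<Sum>i\<in>{1..d}. (\<Prod>l\<in>{1..d}. real (m l)) - (\<Prod>l\<in>{1..d} - {i}. real (m l)))"
    by (intro sum.cong refl term_eq)
  also have "\<dots> = real d * (\<Prod>l\<in>{1..d}. real (m l)) - (\<Sum>i\<in>{1..d}. \<Prod>l\<in>{1..d} - {i}. real (m l))"
    by (simp add: sum_subtractf)
  finally show ?thesis .
qed

section \<open>The total number of descents\<close>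

lemma total_des_eq_sum_steps:
  "total_des d m k = (\<Sum>(i, j)\<in>steps d m. card {w \<in> tensor_words d m k. w j < w i})"
proof -
  have fin: "finite (tensor_words d m k)"
    unfolding tensor_words_def by (intro finite_PiE finite_grid) auto
  have "descents d m w = {p \<in> steps d m. w (snd p) < w (fst p)}" for w
    by (auto simp: descents_def steps_def)
  then have "total_des d m k
      = (\<Sum>w\<in>tensor_words d m k. card {p \<in> steps d m. w (snd p) < w (fst p)})"
    by (simp add: total_des_def des_def)
  also have "\<dots> = (\<Sum>p\<in>steps d m. card {w \<in> tensor_words d m k. w (snd p) < w (fst p)})"
    by (rule sum_multicount_gen[symmetric]) (use fin finite_steps in auto)
  finally show ?thesis
    by (simp add: case_prod_beta)
qed

lemma total_des_closed_form:
  assumes "\<And>l. l \<in> {1..d} \<Longrightarrow> m l \<ge> 1"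
  shows "real (total_des d m k) =
     1 / 2 * (real d * (\<Prod>l\<in>{1..d}. real (m l)) - (\<Sum>i\<in>{1..d}. \<Prod>l\<in>{1..d} - {i}. real (m l)))
     * (real k - 1) * real k ^ ((\<Prod>l\<in>{1..d}. m l) - 1)"
proof -
  let ?c = "1 / 2 * ((real k - 1) * real k ^ ((\<Prod>l\<in>{1..d}. m l) - 1))"
  have "real (card {w \<in> tensor_words d m k. w j < w i}) = ?c" if "(i, j) \<in> steps d m" for i j
  proof -
    have "i \<in> grid d m" "j \<in> grid d m"
      using that by (auto simp: steps_def)
    then show ?thesis
      using card_decreasing_at[of "grid d m" "{1..k}" i j] steps_distinct[OF that]
      by (simp add: finite_grid card_grid tensor_words_def)
  qed
  then have "real (total_des d m k) = (\<Sum>p\<in>steps d m. ?c)"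
    unfolding total_des_eq_sum_steps of_nat_sum by (intro sum.cong) auto
  also have "\<dots> = real (card (steps d m)) * ?c"
    by simp
  finally have "real (total_des d m k) = real (card (steps d m)) * ?c" .
  then show ?thesis
    by (simp only: card_steps[of d m, OF assms] mult_ac)
qed

section \<open>The generating function\<close>

lemma fps_nth_mult_one_minus_X:
  fixes F :: "'a::comm_ring_1 fps"
  shows "fps_nth (F * (1 - fps_const q * fps_X)) n = fps_nth F n - (if n = 0 then 0 else q * fps_nth F (n - 1))"
proof -
  have "F * (1 - fps_const q * fps_X) = F - fps_const q * (fps_X * F)"
    by (simp add: algebra_simps)
  then show ?thesis
    by simp
qed

text \<open>
  Multiplication by \<open>1 - q X\<close> subtracts from each coefficient \<open>q\<close> times the preceding one. Doing
  this once leaves \<open>X\<close> times the geometric series in \<open>q X\<close>, doing it twice leaves \<open>X\<close>.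
\<close>

lemma fps_arith_geometric:
  fixes q :: "'a::comm_ring_1"
  shows "Abs_fps (\<lambda>n. of_nat n * q ^ (n - 1)) * (1 - fps_const q * fps_X) ^ 2 = fps_X"
    (is "?G * ?D ^ 2 = _")
proof -
  have once: "?G * ?D = Abs_fps (\<lambda>n. if n = 0 then 0 else q ^ (n - 1))"
  proof (rule fps_ext)
    fix n show "fps_nth (?G * ?D) n = fps_nth (Abs_fps (\<lambda>n. if n = 0 then 0 else q ^ (n - 1))) n"
    proof (cases n)
      case (Suc n')
      then show ?thesis
        unfolding fps_nth_mult_one_minus_X by (cases n') (auto simp: algebra_simps)
    qed (simp add: fps_nth_mult_one_minus_X)
  qed
  have "(?G * ?D) * ?D = fps_X"
  proof (rule fps_ext)
    fix n show "fps_nth ((?G * ?D) * ?D) n = fps_nth fps_X n"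
    proof (cases n)
      case (Suc n')
      then show ?thesis
        unfolding once fps_nth_mult_one_minus_X by (cases n') auto
    qed (simp add: once fps_nth_mult_one_minus_X)
  qed
  then show ?thesis
    by (simp add: power2_eq_square mult.assoc)
qed

lemma fps_arith_geometric_combination:
  fixes a b q :: "'a::field"
  assumes "\<And>n. n \<ge> 1 \<Longrightarrow> f n = of_nat n * a * q ^ (n - 1) + of_nat (n - 1) * b * q ^ (n - 2)"
  shows "Abs_fps (\<lambda>n. if n \<ge> 1 then f n else 0)
     = (fps_const a * fps_X + fps_const b * fps_X ^ 2) / (1 - fps_const q * fps_X) ^ 2"
    (is "?F = ?N / ?D ^ 2")
proof -
  define G where "G = Abs_fps (\<lambda>n. of_nat n * q ^ (n - 1))"
  have "?F = fps_const a * G + fps_const b * (fps_X * G)"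
    by (rule fps_ext) (auto simp: G_def assms mult_ac numeral_2_eq_2 Suc_le_eq)
  then have "?F * ?D ^ 2 = (fps_const a + fps_const b * fps_X) * (G * ?D ^ 2)"
    by (simp add: algebra_simps)
  also have "\<dots> = ?N"
    unfolding G_def fps_arith_geometric by (simp add: algebra_simps power2_eq_square)
  finally have "?F * ?D ^ 2 = ?N" .
  moreover have "fps_nth (?D ^ 2) 0 \<noteq> 0"
    by (simp add: fps_nth_power_0)
  then have "?D ^ 2 \<noteq> 0"
    by (metis fps_zero_nth)
  ultimately show ?thesis
    by (metis nonzero_mult_div_cancel_right)
qed

text \<open>
  A word of the larger shape is a stack of \<open>n\<close> layers that are filled independently. The first
  summand counts the descents inside a layer, with \<open>n - 1\<close> other layers to fill, the second one
  those between two neighbouring layers, with \<open>n - 2\<close> other layers to fill. The identity itself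
  is read off from the closed formula in both dimensions.
\<close>

lemma total_des_add_dimension:
  assumes m: "\<And>l. l \<in> {1..d} \<Longrightarrow> m l \<ge> 1" and n: "n \<ge> 1"
  shows "real (total_des (d + 1) (m(d + 1 := n)) k) =
     real n * real (total_des d m k) * (real k ^ (\<Prod>l\<in>{1..d}. m l)) ^ (n - 1)
     + real (n - 1) * (1 / 2 * (real k - 1) * real k ^ (2 * (\<Prod>l\<in>{1..d}. m l) - 1)
          * (\<Prod>l\<in>{1..d}. real (m l))) * (real k ^ (\<Prod>l\<in>{1..d}. m l)) ^ (n - 2)"
proof -
  define M where "M = (\<Prod>l\<in>{1..d}. m l)"
  define S where "S = (\<Sum>i\<in>{1..d}. \<Prod>l\<in>{1..d} - {i}. real (m l))"
  have M_ge: "M \<ge> 1"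
    unfolding M_def using m by (intro prod_ge_1) auto
  have M_real: "(\<Prod>l\<in>{1..d}. real (m l)) = real M"
    by (simp add: M_def)
  have ins: "{1..d + 1} = insert (d + 1) {1..d}"
    by auto
  have prod_ext: "(\<Prod>l\<in>{1..d + 1}. (m(d + 1 := n)) l) = n * M"
    unfolding ins M_def by (subst prod.insert) (auto intro!: prod.cong)
  have prod_ext_real: "(\<Prod>l\<in>{1..d + 1}. real ((m(d + 1 := n)) l)) = real n * real M"
    using prod_ext by (metis of_nat_mult of_nat_prod)
  have "(\<Prod>l\<in>{1..d + 1} - {i}. real ((m(d + 1 := n)) l))
      = real n * (\<Prod>l\<in>{1..d} - {i}. real (m l))" if i: "i \<in> {1..d}" for i
  proof -
    have "{1..d + 1} - {i} = insert (d + 1) ({1..d} - {i})"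
      using i by auto
    then show ?thesis
      by (simp only:) (subst prod.insert; auto intro!: prod.cong)
  qed
  moreover have "(\<Prod>l\<in>{1..d + 1} - {d + 1}. real ((m(d + 1 := n)) l)) = real M"
    unfolding M_real[symmetric] by (rule prod.cong) auto
  ultimately have sum_ext:
    "(\<Sum>i\<in>{1..d + 1}. \<Prod>l\<in>{1..d + 1} - {i}. real ((m(d + 1 := n)) l)) = real M + real n * S"
    unfolding S_def sum_distrib_left
    by (subst (1) ins, subst sum.insert) (auto intro!: sum.cong)
  have m': "(m(d + 1 := n)) l \<ge> 1" if "l \<in> {1..d + 1}" for l
    using that m n by auto
  have lhs: "real (total_des (d + 1) (m(d + 1 := n)) k) =
      1 / 2 * (real (d + 1) * (real n * real M) - (real M + real n * S)) * (real k - 1)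
      * real k ^ (n * M - 1)"
    using total_des_closed_form[of "d + 1" "m(d + 1 := n)" k, OF m']
    unfolding prod_ext prod_ext_real sum_ext .
  have a: "real (total_des d m k)
      = 1 / 2 * (real d * real M - S) * (real k - 1) * real k ^ (M - 1)"
    using total_des_closed_form[of d m k, OF m] unfolding M_real S_def M_def[symmetric] by simp
  have "M - 1 + M * (n - 1) = n * M - 1"
    using M_ge n by (cases n) (auto simp: algebra_simps)
  then have pow1: "real k ^ (M - 1) * (real k ^ M) ^ (n - 1) = real k ^ (n * M - 1)"
    by (metis power_add power_mult)
  \<comment> \<open>For \<open>n = 1\<close> the exponents disagree, but the factor \<open>n - 1\<close> vanishes.\<close>
  have pow2: "real (n - 1) * (real k ^ (2 * M - 1) * (real k ^ M) ^ (n - 2))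
      = real (n - 1) * real k ^ (n * M - 1)"
  proof (cases "n = 1")
    case False
    then obtain r where r: "n = r + 2"
      using n by (metis One_nat_def Suc_1 add.commute le_Suc_ex le_antisym not_less_eq_eq)
    have "2 * M - 1 + M * (n - 2) = n * M - 1"
      using M_ge by (simp add: r algebra_simps)
    then show ?thesis
      by (metis power_add power_mult)
  qed simp
  have "real n * real (total_des d m k) * (real k ^ M) ^ (n - 1)
      = real n * (1 / 2 * (real d * real M - S) * (real k - 1))
        * (real k ^ (M - 1) * (real k ^ M) ^ (n - 1))"
    by (simp add: a mult_ac)
  also have "\<dots> = real n * (1 / 2 * (real d * real M - S) * (real k - 1)) * real k ^ (n * M - 1)"
    by (simp only: pow1)
  finally have inside: "real n * real (total_des d m k) * (real k ^ M) ^ (n - 1)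
      = real n * (1 / 2 * (real d * real M - S) * (real k - 1)) * real k ^ (n * M - 1)" .
  have "real (n - 1) * (1 / 2 * (real k - 1) * real k ^ (2 * M - 1) * real M) * (real k ^ M) ^ (n - 2)
      = 1 / 2 * (real k - 1) * real M * (real (n - 1) * (real k ^ (2 * M - 1) * (real k ^ M) ^ (n - 2)))"
    by (simp add: mult_ac)
  also have "\<dots> = 1 / 2 * (real k - 1) * real M * (real (n - 1) * real k ^ (n * M - 1))"
    by (simp only: pow2)
  finally have between: "real (n - 1) * (1 / 2 * (real k - 1) * real k ^ (2 * M - 1) * real M)
        * (real k ^ M) ^ (n - 2)
      = 1 / 2 * (real k - 1) * real M * (real (n - 1) * real k ^ (n * M - 1))" .
  have n_real: "real (n - 1) = real n - 1"
    using n by (simp add: of_nat_diff)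
  show ?thesis
    unfolding M_real M_def[symmetric] inside between lhs
    unfolding n_real by (simp add: algebra_simps)
qed

theorem theorem4:
  fixes k d :: nat and m :: "nat \<Rightarrow> nat"
  assumes "k \<ge> 1" and "d \<ge> 1" and "\<And>l. l \<in> {1..d} \<Longrightarrow> m l \<ge> 1"
  shows "real (total_des d m k) =
           1 / 2 * (real d * (\<Prod>l\<in>{1..d}. real (m l))
                    - (\<Sum>i\<in>{1..d}. \<Prod>l\<in>{1..d} - {i}. real (m l)))
           * (real k - 1) * real k ^ ((\<Prod>l\<in>{1..d}. m l) - 1)
       \<and> total_des_gf d m k =
           (fps_const (real (total_des d m k)) * fps_X
             + fps_const (1 / 2 * (real k - 1) * real k ^ (2 * (\<Prod>l\<in>{1..d}. m l) - 1)
                          * (\<Prod>l\<in>{1..d}. real (m l))) * fps_X ^ 2)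
           / (1 - fps_const (real k ^ (\<Prod>l\<in>{1..d}. m l)) * fps_X) ^ 2"
proof (intro conjI)
  show "real (total_des d m k) =
      1 / 2 * (real d * (\<Prod>l\<in>{1..d}. real (m l))
               - (\<Sum>i\<in>{1..d}. \<Prod>l\<in>{1..d} - {i}. real (m l)))
      * (real k - 1) * real k ^ ((\<Prod>l\<in>{1..d}. m l) - 1)"
    using assms(3) by (rule total_des_closed_form)
  show "total_des_gf d m k =
      (fps_const (real (total_des d m k)) * fps_X
        + fps_const (1 / 2 * (real k - 1) * real k ^ (2 * (\<Prod>l\<in>{1..d}. m l) - 1)
                     * (\<Prod>l\<in>{1..d}. real (m l))) * fps_X ^ 2)
      / (1 - fps_const (real k ^ (\<Prod>l\<in>{1..d}. m l)) * fps_X) ^ 2"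
    unfolding total_des_gf_def
    by (rule fps_arith_geometric_combination, rule total_des_add_dimension)
      (use assms in auto)
qed

end
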